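(* Let $r\ge1$ be an integer and $x$ a nonzero rational number. For every integer $n\ge0$, \[ D_{r,\mathcal{A}}(n;x)=\sum_{j=0}^{r-1}b_{r,j}(n;x)\,D_{r,\mathcal{A}}(j;x)+g_r(n;x)\quad\text{in }\mathcal{A}, \] where, for $0\le j\le r-1$, the $b_{r,j}(n;x)\in\mathbb{Q}$ are defined by $b_{r,j}(n;x)=\delta_{j,n}$ for $0\le n\le r-1$ and $b_{r,j}(n+r;x)=x\sum_{k=0}^{n}\binom{n}{k}b_{r,j}(k;x)$ for $n\ge0$, and $(g_r(n;x))_{n\ge0}$ is defined by $g_r(n;x)=(-1)^{r-1}x\,\delta_{n,r}$ for $0\le n\le r$ and $g_r(n+r;x)=x\sum_{k=0}^{n}\binom{n}{k}g_r(k;x)$ for $n\ge1$.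
   Context: $\mathcal{A}\coloneqq\big(\prod_{p\text{ prime}}\mathbb{Z}/p\mathbb{Z}\big)/\big(\bigoplus_{p\text{ prime}}\mathbb{Z}/p\mathbb{Z}\big)$, a $\mathbb{Q}$-algebra via the diagonal embedding of $\mathbb{Q}$ (for the finitely many primes dividing a denominator, the $p$-component is assigned arbitrarily). For integers $r\ge1,n\ge0,N\ge1$, $D_r^{(N)}(n;x)\coloneqq\sum_{k=0}^{N-1}\frac{k^nx^k}{(k!)^r}$ (with $0^0=1$), and $D_{r,\mathcal{A}}(n;x)\coloneqq(D_r^{(p)}(n;x)\bmod p)_p\in\mathcal{A}$. $\delta$ is the Kronecker delta. *)

theory Defs
  imports "HOL-Algebra.QuotRing" "HOL-Number_Theory.Number_Theory"
begin

section \<open>The product of all prime fields modulo their direct sum\<close>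

definition product_ring :: "'i set \<Rightarrow> ('i \<Rightarrow> ('a, 'b) ring_scheme) \<Rightarrow> ('i \<Rightarrow> 'a) ring" where
  "product_ring I R =
     \<lparr>carrier = \<Pi>\<^sub>E i\<in>I. carrier (R i),
      monoid.mult = \<lambda>f g. \<lambda>i\<in>I. f i \<otimes>\<^bsub>R i\<^esub> g i,
      one = \<lambda>i\<in>I. \<one>\<^bsub>R i\<^esub>,
      zero = \<lambda>i\<in>I. \<zero>\<^bsub>R i\<^esub>,
      add = \<lambda>f g. \<lambda>i\<in>I. f i \<oplus>\<^bsub>R i\<^esub> g i\<rparr>"

definition direct_sum :: "'i set \<Rightarrow> ('i \<Rightarrow> ('a, 'b) ring_scheme) \<Rightarrow> ('i \<Rightarrow> 'a) set" where
  "direct_sum I R = {f \<in> carrier (product_ring I R). finite {i \<in> I. f i \<noteq> \<zero>\<^bsub>R i\<^esub>}}"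

definition Primes :: "nat set" where
  "Primes = {p. prime p}"

definition prod_Fp :: "(nat \<Rightarrow> int) ring" where
  "prod_Fp = product_ring Primes (\<lambda>p. residue_ring (int p))"

definition sum_Fp :: "(nat \<Rightarrow> int) set" where
  "sum_Fp = direct_sum Primes (\<lambda>p. residue_ring (int p))"

definition ring_A :: "(nat \<Rightarrow> int) set ring" where
  "ring_A = prod_Fp Quot sum_Fp"

text \<open>
  Reduction of a rational number modulo \<open>p\<close>. It is meaningful when \<open>p\<close> does not divide the
  denominator; otherwise \<^const>\<open>modular_inverse\<close> is \<open>0\<close>, so the (arbitrary) value is \<open>0\<close>.
\<close>
definition rat_mod :: "nat \<Rightarrow> rat \<Rightarrow> int" where
  "rat_mod p q =
     (case quotient_of q of (a, b) \<Rightarrow> (a * modular_inverse (int p) b) mod int p)"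

text \<open>The element \<open>(q\<^sub>p mod p)\<^sub>p\<close> of \<^const>\<open>ring_A\<close> for a family \<open>(q\<^sub>p)\<^sub>p\<close> of rational numbers.\<close>
definition class_A :: "(nat \<Rightarrow> rat) \<Rightarrow> (nat \<Rightarrow> int) set" where
  "class_A q = sum_Fp +>\<^bsub>prod_Fp\<^esub> (\<lambda>p\<in>Primes. rat_mod p (q p))"

definition rat_A :: "rat \<Rightarrow> (nat \<Rightarrow> int) set" where
  "rat_A c = class_A (\<lambda>_. c)"


section \<open>The truncated sums and the recursively defined coefficients\<close>

definition D_sum :: "nat \<Rightarrow> nat \<Rightarrow> nat \<Rightarrow> rat \<Rightarrow> rat" where
  "D_sum r N n x = (\<Sum>k<N. of_nat k ^ n * x ^ k / fact k ^ r)"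

definition D_A :: "nat \<Rightarrow> nat \<Rightarrow> rat \<Rightarrow> (nat \<Rightarrow> int) set" where
  "D_A r n x = class_A (\<lambda>p. D_sum r p n x)"

text \<open>
  The disjunct \<open>r = 0\<close> in the following two definitions only serves termination;
  the lemmas below restate the recursions for \<open>r \<ge> 1\<close>.
\<close>
fun b_coeff :: "nat \<Rightarrow> nat \<Rightarrow> nat \<Rightarrow> rat \<Rightarrow> rat" where
  "b_coeff r j n x =
     (if r = 0 \<or> n < r then (if j = n then 1 else 0)
      else x * (\<Sum>k\<le>n - r. of_nat ((n - r) choose k) * b_coeff r j k x))"

fun g_coeff :: "nat \<Rightarrow> nat \<Rightarrow> rat \<Rightarrow> rat" where
  "g_coeff r n x =
     (if r = 0 \<or> n \<le> r then (-1) ^ (r - 1) * x * (if n = r then 1 else 0)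
      else x * (\<Sum>k\<le>n - r. of_nat ((n - r) choose k) * g_coeff r k x))"

declare b_coeff.simps [simp del] g_coeff.simps [simp del]

lemma b_coeff_initial: "n < r \<Longrightarrow> b_coeff r j n x = (if j = n then 1 else 0)"
  by (simp add: b_coeff.simps)

lemma b_coeff_rec:
  "r \<ge> 1 \<Longrightarrow> b_coeff r j (n + r) x = x * (\<Sum>k\<le>n. of_nat (n choose k) * b_coeff r j k x)"
  by (subst b_coeff.simps) simp

lemma g_coeff_initial: "n \<le> r \<Longrightarrow> g_coeff r n x = (-1) ^ (r - 1) * x * (if n = r then 1 else 0)"
  by (simp add: g_coeff.simps)

lemma g_coeff_rec:
  "r \<ge> 1 \<Longrightarrow> n \<ge> 1 \<Longrightarrow>
     g_coeff r (n + r) x = x * (\<Sum>k\<le>n. of_nat (n choose k) * g_coeff r k x)"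
  by (subst g_coeff.simps) simp


section \<open>Well-definedness\<close>

lemma PiE_carrier: "f \<in> (\<Pi>\<^sub>E i\<in>I. carrier (R i)) \<Longrightarrow> i \<in> I \<Longrightarrow> f i \<in> carrier (R i)"
  by auto

lemma cring_product_ring:
  assumes "\<And>i. i \<in> I \<Longrightarrow> cring (R i)"
  shows "cring (product_ring I R)"
proof (rule cringI)
  have r: "ring (R i)" "abelian_monoid (R i)" "comm_monoid (R i)" "monoid (R i)" if "i \<in> I" for i
    using assms[OF that] by (auto simp: cring_def ring_def abelian_group_def)
  show "abelian_group (product_ring I R)"
  proof (rule abelian_groupI)
    fix f assume f: "f \<in> carrier (product_ring I R)"
    have "(\<lambda>i\<in>I. \<ominus>\<^bsub>R i\<^esub> f i) \<in> carrier (product_ring I R)"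
      using f assms by (auto simp: product_ring_def cring_def ring_def intro!: abelian_group.a_inv_closed)
    moreover have "(\<lambda>i\<in>I. \<ominus>\<^bsub>R i\<^esub> f i) \<oplus>\<^bsub>product_ring I R\<^esub> f = \<zero>\<^bsub>product_ring I R\<^esub>"
      using f assms by (auto simp: product_ring_def cring_def ring_def PiE_mem 
          intro!: restrict_ext abelian_group.l_neg)
    ultimately show "\<exists>g\<in>carrier (product_ring I R). g \<oplus>\<^bsub>product_ring I R\<^esub> f = \<zero>\<^bsub>product_ring I R\<^esub>"
      by blast
  next
    fix f assume f: "f \<in> carrier (product_ring I R)"
    show "\<zero>\<^bsub>product_ring I R\<^esub> \<oplus>\<^bsub>product_ring I R\<^esub> f = f"
    proof (rule extensionalityI[of _ I])
      fix i assume i: "i \<in> I"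
      hence "f i \<in> carrier (R i)" using f by (auto simp: product_ring_def)
      thus "(\<zero>\<^bsub>product_ring I R\<^esub> \<oplus>\<^bsub>product_ring I R\<^esub> f) i = f i"
        using i r(2)[OF i] by (simp add: product_ring_def abelian_monoid.l_zero)
    qed (use f in \<open>auto simp: product_ring_def PiE_def\<close>)
  qed (auto simp: product_ring_def r PiE_carrier abelian_monoid.a_closed abelian_monoid.zero_closed
        intro!: restrict_ext abelian_monoid.a_assoc abelian_monoid.a_comm)
  show "comm_monoid (product_ring I R)"
  proof (rule comm_monoidI)
    fix f assume f: "f \<in> carrier (product_ring I R)"
    show "\<one>\<^bsub>product_ring I R\<^esub> \<otimes>\<^bsub>product_ring I R\<^esub> f = f"
    proof (rule extensionalityI[of _ I])
      fix i assume i: "i \<in> I"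
      hence "f i \<in> carrier (R i)" using f by (auto simp: product_ring_def)
      thus "(\<one>\<^bsub>product_ring I R\<^esub> \<otimes>\<^bsub>product_ring I R\<^esub> f) i = f i"
        using i r(4)[OF i] by (simp add: product_ring_def monoid.l_one)
    qed (use f in \<open>auto simp: product_ring_def PiE_def\<close>)
  qed (auto simp: product_ring_def r PiE_carrier monoid.m_closed monoid.one_closed
        intro!: restrict_ext monoid.m_assoc comm_monoid.m_comm)
  fix f g h
  assume "f \<in> carrier (product_ring I R)" "g \<in> carrier (product_ring I R)"
    "h \<in> carrier (product_ring I R)"
  thus "(f \<oplus>\<^bsub>product_ring I R\<^esub> g) \<otimes>\<^bsub>product_ring I R\<^esub> h =
          f \<otimes>\<^bsub>product_ring I R\<^esub> h \<oplus>\<^bsub>product_ring I R\<^esub> g \<otimes>\<^bsub>product_ring I R\<^esub> h"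
    by (simp add: product_ring_def r PiE_carrier ring.ring_simprules(13) cong: restrict_cong)
qed

lemma ideal_direct_sum:
  assumes "\<And>i. i \<in> I \<Longrightarrow> cring (R i)"
  shows "ideal (direct_sum I R) (product_ring I R)"
proof -
  interpret P: cring "product_ring I R"
    by (rule cring_product_ring) (rule assms)
  have r: "ring (R i)" "abelian_monoid (R i)" if "i \<in> I" for i
    using assms[OF that] by (auto simp: cring_def ring_def abelian_group_def)
  show ?thesis
  proof (rule idealI)
    show "subgroup (direct_sum I R) (add_monoid (product_ring I R))"
    proof (rule P.add.subgroupI)
      show "direct_sum I R \<subseteq> carrier (product_ring I R)"
        by (auto simp: direct_sum_def)
      have "\<zero>\<^bsub>product_ring I R\<^esub> \<in> direct_sum I R"
        using P.zero_closed by (auto simp: direct_sum_def) (simp add: product_ring_def cong: conj_cong)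
      thus "direct_sum I R \<noteq> {}" by blast
    next
      fix f assume f: "f \<in> direct_sum I R"
      hence fc: "f \<in> carrier (product_ring I R)" by (simp add: direct_sum_def)
      let ?g = "\<lambda>i\<in>I. \<ominus>\<^bsub>R i\<^esub> f i"
      have gc: "?g \<in> carrier (product_ring I R)"
        using fc assms by (auto simp: product_ring_def cring_def ring_def intro!: abelian_group.a_inv_closed)
      have "?g \<oplus>\<^bsub>product_ring I R\<^esub> f = \<zero>\<^bsub>product_ring I R\<^esub>"
        using fc assms by (auto simp: product_ring_def cring_def ring_def PiE_mem 
            intro!: restrict_ext abelian_group.l_neg)
      hence g: "\<ominus>\<^bsub>product_ring I R\<^esub> f = ?g"
        using fc gc by (metis P.minus_equality)
      have "\<ominus>\<^bsub>R i\<^esub> \<zero>\<^bsub>R i\<^esub> = \<zero>\<^bsub>R i\<^esub>" if "i \<in> I" for i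
        using r(1)[OF that] by (simp add: ring.ring_simprules)
      hence "{i \<in> I. ?g i \<noteq> \<zero>\<^bsub>R i\<^esub>} \<subseteq> {i \<in> I. f i \<noteq> \<zero>\<^bsub>R i\<^esub>}"
        by auto
      moreover have "finite {i \<in> I. f i \<noteq> \<zero>\<^bsub>R i\<^esub>}"
        using f by (simp add: direct_sum_def)
      ultimately have "finite {i \<in> I. ?g i \<noteq> \<zero>\<^bsub>R i\<^esub>}"
        by (rule finite_subset)
      thus "\<ominus>\<^bsub>product_ring I R\<^esub> f \<in> direct_sum I R"
        using gc unfolding g direct_sum_def by blast
    next
      fix f g assume fg: "f \<in> direct_sum I R" "g \<in> direct_sum I R"
      have "{i \<in> I. (f \<oplus>\<^bsub>product_ring I R\<^esub> g) i \<noteq> \<zero>\<^bsub>R i\<^esub>}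
              \<subseteq> {i \<in> I. f i \<noteq> \<zero>\<^bsub>R i\<^esub>} \<union> {i \<in> I. g i \<noteq> \<zero>\<^bsub>R i\<^esub>}"
        by (auto simp: product_ring_def r abelian_monoid.l_zero abelian_monoid.zero_closed)
      thus "f \<oplus>\<^bsub>product_ring I R\<^esub> g \<in> direct_sum I R"
        using fg by (auto simp: direct_sum_def intro: finite_subset)
    qed
  next
    fix f g assume f: "f \<in> direct_sum I R" and g: "g \<in> carrier (product_ring I R)"
    have gi: "g i \<in> carrier (R i)" if "i \<in> I" for i
      using g that by (auto simp: product_ring_def)
    have "{i \<in> I. (g \<otimes>\<^bsub>product_ring I R\<^esub> f) i \<noteq> \<zero>\<^bsub>R i\<^esub>} \<subseteq> {i \<in> I. f i \<noteq> \<zero>\<^bsub>R i\<^esub>}"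
      using gi r by (auto simp: product_ring_def ring.ring_simprules(25))
    thus *: "g \<otimes>\<^bsub>product_ring I R\<^esub> f \<in> direct_sum I R"
      using f g by (auto simp: direct_sum_def intro: finite_subset)
    show "f \<otimes>\<^bsub>product_ring I R\<^esub> g \<in> direct_sum I R"
      using * f g by (simp add: P.m_comm direct_sum_def)
  qed (rule P.ring_axioms)
qed

lemma cring_residue_ring: "p \<in> Primes \<Longrightarrow> cring (residue_ring (int p))"
  using prime_gt_1_nat[of p] by (intro residues.cring) (simp_all add: residues_def Primes_def)

lemma cring_prod_Fp: "cring prod_Fp"
  unfolding prod_Fp_def by (intro cring_product_ring cring_residue_ring)

lemma ideal_sum_Fp: "ideal sum_Fp prod_Fp"
  unfolding prod_Fp_def sum_Fp_def by (intro ideal_direct_sum cring_residue_ring)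

lemma cring_ring_A: "cring ring_A"
  unfolding ring_A_def by (intro ideal.quotient_is_cring ideal_sum_Fp cring_prod_Fp)

lemma rat_mod_closed: "p \<in> Primes \<Longrightarrow> rat_mod p q \<in> carrier (residue_ring (int p))"
  using prime_gt_0_nat[of p]
  by (auto simp: rat_mod_def residue_ring_def Primes_def split: prod.splits)

lemma class_A_closed: "class_A q \<in> carrier ring_A"
proof -
  have "(\<lambda>p\<in>Primes. rat_mod p (q p)) \<in> carrier prod_Fp"
    using rat_mod_closed by (auto simp: prod_Fp_def product_ring_def)
  thus ?thesis
    by (auto simp: class_A_def ring_A_def FactRing_def A_RCOSETS_def')
qed

text \<open>\<^const>\<open>rat_mod\<close> may be computed from any fraction whose denominator is prime to \<open>p\<close>.\<close>
lemma rat_mod_of_fraction: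
  assumes "prime p" and "\<not> int p dvd d"
  shows "[rat_mod p (of_int a / of_int d) * d = a] (mod int p)"
proof -
  obtain u v where uv: "quotient_of (of_int a / of_int d) = (u, v)" by fastforce
  have v: "v > 0" "coprime u v" and eq: "(of_int a / of_int d :: rat) = of_int u / of_int v"
    using uv quotient_of_denom_pos quotient_of_coprime quotient_of_div by blast+
  have "d \<noteq> 0" using assms by auto
  hence "of_int (a * v) = (of_int (u * d) :: rat)"
    using eq v by (simp add: field_simps)
  hence av: "a * v = u * d" by (simp only: of_int_eq_iff)
  hence "v dvd d" using v by (metis coprime_commute coprime_dvd_mult_right_iff dvd_triv_right)
  hence "\<not> int p dvd v" using assms by (meson dvd_trans)
  hence cop: "coprime v (int p)"
    using assms by (metis coprime_commute prime_imp_coprime prime_nat_int_transfer)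
  let ?i = "modular_inverse (int p) v"
  have "[rat_mod p (of_int a / of_int d) * d = u * ?i * d] (mod int p)"
    by (simp add: rat_mod_def uv cong_def mod_mult_left_eq)
  also have "u * ?i * d = a * (?i * v)" using av by (simp add: algebra_simps)
  also have "[a * (?i * v) = a * 1] (mod int p)"
    by (intro cong_mult cong_refl cong_modular_inverse2 cop)
  finally show ?thesis by simp
qed

lemma finite_prime_divisors_int:
  assumes "d \<noteq> 0"
  shows "finite {p \<in> Primes. int p dvd d}"
proof (rule finite_subset)
  show "{p \<in> Primes. int p dvd d} \<subseteq> {..nat \<bar>d\<bar>}"
    using assms by (auto dest!: dvd_imp_le_int)
qed simp

lemma coset_sum_Fp_eqI:
  assumes f: "f \<in> carrier prod_Fp" and g: "g \<in> carrier prod_Fp"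
    and fin: "finite {p \<in> Primes. f p \<noteq> g p}"
  shows "sum_Fp +>\<^bsub>prod_Fp\<^esub> f = sum_Fp +>\<^bsub>prod_Fp\<^esub> g"
proof -
  interpret ideal sum_Fp prod_Fp by (rule ideal_sum_Fp)
  define d where "d = (\<lambda>p\<in>Primes. (f p - g p) mod int p)"
  have range: "f p \<in> {0..int p - 1}" "g p \<in> {0..int p - 1}" "p > 0" if "p \<in> Primes" for p
    using f g that prime_gt_0_nat[of p]
    by (auto simp: prod_Fp_def product_ring_def residue_ring_def Primes_def)
  have "{p \<in> Primes. d p \<noteq> 0} \<subseteq> {p \<in> Primes. f p \<noteq> g p}"
    by (auto simp: d_def)
  hence "finite {p \<in> Primes. d p \<noteq> 0}"
    using fin by (rule finite_subset)
  moreover have "d p \<in> {0..int p - 1}" if "p \<in> Primes" for p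
    using range(3)[OF that] that by (simp add: d_def)
  hence "d \<in> carrier prod_Fp"
    by (auto simp: prod_Fp_def product_ring_def residue_ring_def d_def)
  ultimately have d: "d \<in> sum_Fp"
    by (simp add: sum_Fp_def direct_sum_def prod_Fp_def residue_ring_def)
  have "d \<oplus>\<^bsub>prod_Fp\<^esub> g = f"
  proof (rule extensionalityI[of _ Primes])
    fix p assume p: "p \<in> Primes"
    have "(d \<oplus>\<^bsub>prod_Fp\<^esub> g) p = ((f p - g p) mod int p + g p) mod int p"
      using p by (simp add: prod_Fp_def product_ring_def residue_ring_def d_def)
    also have "\<dots> = f p mod int p" by (simp add: mod_add_left_eq)
    also have "\<dots> = f p" using range[OF p] by simp
    finally show "(d \<oplus>\<^bsub>prod_Fp\<^esub> g) p = f p" .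
  qed (use f in \<open>auto simp: prod_Fp_def product_ring_def PiE_def\<close>)
  hence "f \<in> sum_Fp +>\<^bsub>prod_Fp\<^esub> g"
    using d by (auto simp: a_r_coset_def')
  thus ?thesis
    using a_repr_independence[OF _ g a_subgroup] by simp
qed

lemma rat_A_1: "rat_A 1 = \<one>\<^bsub>ring_A\<^esub>"
proof -
  have "rat_mod p 1 = 1" if "p \<in> Primes" for p
    using rat_mod_of_fraction[of p 1 1] rat_mod_closed[OF that, of 1] that prime_gt_1_nat[of p]
    by (auto simp: Primes_def cong_def residue_ring_def)
  hence "(\<lambda>p\<in>Primes. rat_mod p 1) = \<one>\<^bsub>prod_Fp\<^esub>"
    by (auto simp: prod_Fp_def product_ring_def residue_ring_def)
  thus ?thesis
    by (simp add: rat_A_def class_A_def ring_A_def FactRing_def)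
qed

lemma rat_mod_add_mult:
  assumes p: "p \<in> Primes" and "\<not> int p dvd d" "\<not> int p dvd d'"
    and q_def: "q = of_int a / of_int d" and q'_def: "q' = of_int a' / of_int d'"
  shows "rat_mod p (q + q') = (rat_mod p q + rat_mod p q') mod int p"
    and "rat_mod p (q * q') = (rat_mod p q * rat_mod p q') mod int p"
proof -
  have pr: "prime (int p)" "prime p" using p by (auto simp: Primes_def)
  have nd: "\<not> int p dvd d * d'" using assms pr by (simp add: prime_dvd_mult_iff)
  hence "d \<noteq> 0" "d' \<noteq> 0" by auto
  hence eq: "q + q' = of_int (a * d' + a' * d) / of_int (d * d')" "q * q' = of_int (a * a') / of_int (d * d')"
    by (auto simp: q_def q'_def field_simps)
  have cop: "coprime (d * d') (int p)"
    using nd pr by (metis coprime_commute prime_imp_coprime)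
  have *: "rat_mod p x = y mod int p" if "[rat_mod p x * (d * d') = y * (d * d')] (mod int p)" for x y
  proof -
    have "[rat_mod p x = y] (mod int p)"
      using that cop by (simp add: cong_mult_rcancel)
    thus ?thesis
      using rat_mod_closed[OF p, of x] by (auto simp: cong_def residue_ring_def)
  qed
  have c: "[rat_mod p q * d = a] (mod int p)" "[rat_mod p q' * d' = a'] (mod int p)"
    unfolding q_def q'_def using assms pr by (auto intro: rat_mod_of_fraction)
  have "[rat_mod p (q + q') * (d * d') = a * d' + a' * d] (mod int p)"
    unfolding eq using nd pr by (intro rat_mod_of_fraction)
  also have "[a * d' + a' * d = rat_mod p q * d * d' + rat_mod p q' * d' * d] (mod int p)"
    by (intro cong_add cong_mult cong_refl cong_sym[OF c(1)] cong_sym[OF c(2)])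
  also have "rat_mod p q * d * d' + rat_mod p q' * d' * d = (rat_mod p q + rat_mod p q') * (d * d')"
    by (simp add: algebra_simps)
  finally show "rat_mod p (q + q') = (rat_mod p q + rat_mod p q') mod int p"
    by (rule *)
  have "[rat_mod p (q * q') * (d * d') = a * a'] (mod int p)"
    unfolding eq using nd pr by (intro rat_mod_of_fraction)
  also have "[a * a' = (rat_mod p q * d) * (rat_mod p q' * d')] (mod int p)"
    by (intro cong_mult cong_sym[OF c(1)] cong_sym[OF c(2)])
  also have "(rat_mod p q * d) * (rat_mod p q' * d') = (rat_mod p q * rat_mod p q') * (d * d')"
    by (simp add: algebra_simps)
  finally show "rat_mod p (q * q') = (rat_mod p q * rat_mod p q') mod int p"
    by (rule *)
qed

lemma
  shows rat_A_add: "rat_A (q + q') = rat_A q \<oplus>\<^bsub>ring_A\<^esub> rat_A q'"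
    and rat_A_mult: "rat_A (q * q') = rat_A q \<otimes>\<^bsub>ring_A\<^esub> rat_A q'"
proof -
  obtain a d where "quotient_of q = (a, d)" by fastforce
  hence q: "q = of_int a / of_int d" "d > 0"
    using quotient_of_div quotient_of_denom_pos by blast+
  obtain a' d' where "quotient_of q' = (a', d')" by fastforce
  hence q': "q' = of_int a' / of_int d'" "d' > 0"
    using quotient_of_div quotient_of_denom_pos by blast+
  interpret P: cring prod_Fp by (rule cring_prod_Fp)
  interpret H: ring_hom_ring prod_Fp ring_A "\<lambda>f. sum_Fp +>\<^bsub>prod_Fp\<^esub> f"
    using ideal.rcos_ring_hom_ring[OF ideal_sum_Fp] by (simp add: ring_A_def)
  let ?f = "\<lambda>q. \<lambda>p\<in>Primes. rat_mod p q"
  have f: "?f q \<in> carrier prod_Fp" for q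
    using rat_mod_closed by (auto simp: prod_Fp_def product_ring_def)
  have rm: "rat_mod p (q + q') = (rat_mod p q + rat_mod p q') mod int p"
           "rat_mod p (q * q') = (rat_mod p q * rat_mod p q') mod int p"
    if "p \<in> Primes" "\<not> int p dvd d" "\<not> int p dvd d'" for p
    using rat_mod_add_mult[OF that q(1) q'(1)] by blast+
  have fin: "finite ({p \<in> Primes. int p dvd d} \<union> {p \<in> Primes. int p dvd d'})"
    using q q' by (intro finite_UnI finite_prime_divisors_int) auto
  have "finite {p \<in> Primes. ?f (q + q') p \<noteq> (?f q \<oplus>\<^bsub>prod_Fp\<^esub> ?f q') p}"
    by (rule finite_subset[OF _ fin])
       (auto simp: prod_Fp_def product_ring_def residue_ring_def; use rm(1) in blast)
  thus "rat_A (q + q') = rat_A q \<oplus>\<^bsub>ring_A\<^esub> rat_A q'"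
    unfolding rat_A_def class_A_def H.hom_add [OF f f, symmetric]
    by (intro coset_sum_Fp_eqI f P.a_closed)
  have "finite {p \<in> Primes. ?f (q * q') p \<noteq> (?f q \<otimes>\<^bsub>prod_Fp\<^esub> ?f q') p}"
    by (rule finite_subset[OF _ fin])
       (auto simp: prod_Fp_def product_ring_def residue_ring_def; use rm(2) in blast)
  thus "rat_A (q * q') = rat_A q \<otimes>\<^bsub>ring_A\<^esub> rat_A q'"
    unfolding rat_A_def class_A_def H.hom_mult [OF f f, symmetric]
    by (intro coset_sum_Fp_eqI f P.m_closed)
qed

end

theory Submission
  imports Defs
begin

text \<open>
  Shifting the summation index and expanding \<open>(k + 1)\<^sup>n\<close> shows that the truncated sums satisfy
  the recursion of the coefficients up to the boundary term
  \<open>x p\<^sup>n x\<^sup>p\<^sup>-\<^sup>1 / (p - 1)!\<^sup>r\<close>. Modulo \<open>p\<close> this term vanishes for \<open>n \<ge> 1\<close>, and for \<open>n = 0\<close> it is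
  \<open>(-1)\<^sup>r x\<close> by the theorems of Fermat and Wilson; the negative of that is \<open>g\<^sub>r(r)\<close>. So the
  claimed identity holds, by induction on \<open>n\<close>, as a congruence in the localisation of the integers
  at every prime \<open>p\<close> dividing neither the numerator nor the denominator of \<open>x\<close>.
\<close>

section \<open>Rational numbers integral at a prime\<close>

text \<open>For prime \<open>p\<close> this is the localisation of the integers at \<open>p\<close>.
  The fraction need not be in lowest terms, so sums and products are witnessed without
  cancelling.\<close>

definition p_integral :: "nat \<Rightarrow> rat \<Rightarrow> bool" where
  "p_integral p q \<longleftrightarrow> (\<exists>a d. \<not> int p dvd d \<and> q = of_int a / of_int d)"

lemma p_integral_fraction: "\<not> int p dvd d \<Longrightarrow> p_integral p (of_int a / of_int d)"
  by (auto simp: p_integral_def)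

lemma p_integral_of_int: "prime p \<Longrightarrow> p_integral p (of_int a)"
  using p_integral_fraction[of p 1 a] prime_gt_1_nat[of p] by auto

lemma p_integral_of_nat: "prime p \<Longrightarrow> p_integral p (of_nat a)"
  using p_integral_of_int[of p "int a"] by simp

lemma p_integral_0: "prime p \<Longrightarrow> p_integral p 0"
  using p_integral_of_int[of p 0] by simp

lemma p_integral_1: "prime p \<Longrightarrow> p_integral p 1"
  using p_integral_of_int[of p 1] by simp

lemma
  assumes p: "prime p" and q: "p_integral p q" and q': "p_integral p q'"
  shows p_integral_add: "p_integral p (q + q')"
    and p_integral_mult: "p_integral p (q * q')"
proof -
  obtain a d where ad: "\<not> int p dvd d" "q = of_int a / of_int d"
    using q by (auto simp: p_integral_def)
  obtain a' d' where ad': "\<not> int p dvd d'" "q' = of_int a' / of_int d'"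
    using q' by (auto simp: p_integral_def)
  have "d \<noteq> 0" "d' \<noteq> 0" using ad ad' by auto
  hence "q + q' = of_int (a * d' + a' * d) / of_int (d * d')"
    "q * q' = of_int (a * a') / of_int (d * d')"
    by (simp_all add: ad ad' field_simps)
  moreover have "\<not> int p dvd d * d'"
    using ad ad' p by (simp add: prime_dvd_mult_iff)
  ultimately show "p_integral p (q + q')" "p_integral p (q * q')"
    by (simp_all only: p_integral_fraction not_False_eq_True)
qed

lemma p_integral_minus: "prime p \<Longrightarrow> p_integral p q \<Longrightarrow> p_integral p (- q)"
  using p_integral_mult[of p "-1" q] p_integral_of_int[of p "-1"] by simp

lemma p_integral_power: "prime p \<Longrightarrow> p_integral p q \<Longrightarrow> p_integral p (q ^ n)"
  by (induction n) (auto intro: p_integral_1 p_integral_mult)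

lemma p_integral_sum:
  "prime p \<Longrightarrow> (\<And>i. i \<in> S \<Longrightarrow> p_integral p (f i)) \<Longrightarrow> p_integral p (sum f S)"
  by (induction S rule: infinite_finite_induct) (auto intro: p_integral_0 p_integral_add)

text \<open>A prime divides \<open>k!\<close> only if it is at most \<open>k\<close>. Hence
  truncation at \<open>p\<close> keeps every summand of \<open>D_sum r p n x\<close> integral when
  \<open>x\<close> is.\<close>

lemma p_integral_inverse_fact:
  assumes "prime p" "k < p"
  shows "p_integral p (1 / fact k)"
proof -
  have "\<not> p dvd fact k"
    using assms by (simp add: prime_dvd_fact_iff)
  hence "\<not> int p dvd fact k"
    by (metis int_dvd_int_iff of_nat_fact)
  thus ?thesis
    using p_integral_fraction[of p "fact k" 1] by simp
qed

lemmas p_integral_intros = p_integral_of_int p_integral_of_nat p_integral_0 p_integral_1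
  p_integral_add p_integral_mult p_integral_minus p_integral_power p_integral_sum

text \<open>Congruence modulo the maximal ideal of the local ring. Only the quotient
  \<open>z\<close> has to be integral, so boundary terms can be compared before their integrality is
  known.\<close>

definition p_cong :: "nat \<Rightarrow> rat \<Rightarrow> rat \<Rightarrow> bool" where
  "p_cong p u v \<longleftrightarrow> (\<exists>z. p_integral p z \<and> u = v + of_nat p * z)"

lemma p_cong_refl: "prime p \<Longrightarrow> p_cong p u u"
  unfolding p_cong_def by (intro exI[of _ 0]) (simp add: p_integral_0)

lemma p_cong_add:
  assumes "prime p" "p_cong p u v" "p_cong p u' v'"
  shows "p_cong p (u + u') (v + v')"
proof -
  obtain z z' where "p_integral p z" "u = v + of_nat p * z" "p_integral p z'" "u' = v' + of_nat p * z'"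
    using assms by (auto simp: p_cong_def)
  with assms(1) show ?thesis
    unfolding p_cong_def by (intro exI[of _ "z + z'"]) (auto simp: algebra_simps p_integral_add)
qed

lemma p_cong_mult_left:
  assumes "prime p" "p_integral p c" "p_cong p u v"
  shows "p_cong p (c * u) (c * v)"
proof -
  obtain z where "p_integral p z" "u = v + of_nat p * z"
    using assms by (auto simp: p_cong_def)
  with assms show ?thesis
    unfolding p_cong_def by (intro exI[of _ "c * z"]) (auto simp: algebra_simps p_integral_mult)
qed

lemma p_cong_sum:
  "prime p \<Longrightarrow> (\<And>i. i \<in> S \<Longrightarrow> p_cong p (f i) (h i)) \<Longrightarrow> p_cong p (sum f S) (sum h S)"
  by (induction S rule: infinite_finite_induct) (auto intro: p_cong_refl p_cong_add)

text \<open>On the local ring, \<open>rat_mod p\<close> is a ring homomorphism to the prime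
  field.\<close>

lemma
  assumes p: "p \<in> Primes" and q: "p_integral p q" and q': "p_integral p q'"
  shows rat_mod_add: "rat_mod p (q + q') = (rat_mod p q + rat_mod p q') mod int p"
    and rat_mod_mult: "rat_mod p (q * q') = (rat_mod p q * rat_mod p q') mod int p"
  using rat_mod_add_mult[OF p] q q' by (auto simp: p_integral_def)

text \<open>The homomorphism \<open>rat_mod p\<close> sends \<open>p\<close> to 0, hence also every
  integral multiple of \<open>p\<close>.\<close>

lemma rat_mod_eq_if_p_cong:
  assumes p: "p \<in> Primes" and v: "p_integral p v" and uv: "p_cong p u v"
  shows "rat_mod p u = rat_mod p v"
proof -
  have pr: "prime p" using p by (simp add: Primes_def)
  have range: "rat_mod p w \<in> {0..<int p}" for w
    using rat_mod_closed[OF p, of w] by (auto simp: residue_ring_def)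
  obtain z where z: "p_integral p z" "u = v + of_nat p * z"
    using uv by (auto simp: p_cong_def)
  have "[rat_mod p (of_nat p) = int p] (mod int p)"
    using rat_mod_of_fraction[of p 1 "int p"] prime_gt_1_nat[OF pr] pr by auto
  hence "rat_mod p (of_nat p) = 0"
    using range[of "of_nat p"] by (simp add: cong_def)
  hence "rat_mod p (of_nat p * z) = 0"
    by (simp add: rat_mod_mult[OF p p_integral_of_nat[OF pr] z(1)])
  thus ?thesis
    using range[of v] z pr
    by (simp add: rat_mod_add[OF p v] p_integral_mult p_integral_of_nat)
qed

section \<open>Arithmetic of classes of almost everywhere integral families\<close>

text \<open>Eventually along this filter means at all primes outside a finite set, so changes at the
  exceptional primes are absorbed by \<open>sum_Fp\<close>.\<close>

abbreviation almost_all_primes :: "nat filter" where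
  "almost_all_primes \<equiv> inf cofinite (principal Primes)"

lemma eventually_almost_all_primes:
  "eventually P almost_all_primes \<longleftrightarrow> finite {p \<in> Primes. \<not> P p}"
  by (simp add: eventually_inf_principal eventually_cofinite)

lemma eventually_in_Primes: "eventually (\<lambda>p. p \<in> Primes) almost_all_primes"
  by (simp add: eventually_inf_principal)

lemma rat_mod_family_closed: "(\<lambda>p\<in>Primes. rat_mod p (q p)) \<in> carrier prod_Fp"
  using rat_mod_closed by (auto simp: prod_Fp_def product_ring_def)

lemma class_A_eqI:
  assumes "eventually (\<lambda>p. rat_mod p (q p) = rat_mod p (q' p)) almost_all_primes"
  shows "class_A q = class_A q'"
  unfolding class_A_def using assms
  by (intro coset_sum_Fp_eqI rat_mod_family_closed)
     (simp add: eventually_almost_all_primes cong: conj_cong)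

text \<open>The coset map is a ring homomorphism, so it suffices to compare components at almost all
  primes. Unlike for \<open>rat_A\<close>, the rational number may vary with
  \<open>p\<close>.\<close>

lemma
  assumes q: "eventually (\<lambda>p. p_integral p (q p)) almost_all_primes"
    and q': "eventually (\<lambda>p. p_integral p (q' p)) almost_all_primes"
  shows class_A_add: "class_A (\<lambda>p. q p + q' p) = class_A q \<oplus>\<^bsub>ring_A\<^esub> class_A q'"
    and class_A_mult: "class_A (\<lambda>p. q p * q' p) = class_A q \<otimes>\<^bsub>ring_A\<^esub> class_A q'"
proof -
  interpret P: cring prod_Fp by (rule cring_prod_Fp)
  interpret H: ring_hom_ring prod_Fp ring_A "\<lambda>f. sum_Fp +>\<^bsub>prod_Fp\<^esub> f"
    using ideal.rcos_ring_hom_ring[OF ideal_sum_Fp] by (simp add: ring_A_def)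
  let ?f = "\<lambda>q. \<lambda>p\<in>Primes. rat_mod p (q p)"
  note f = rat_mod_family_closed
  have "eventually (\<lambda>p. ?f (\<lambda>p. q p + q' p) p = (?f q \<oplus>\<^bsub>prod_Fp\<^esub> ?f q') p) almost_all_primes"
    using q q' eventually_in_Primes
    by eventually_elim
       (simp add: prod_Fp_def product_ring_def residue_ring_def rat_mod_add)
  thus "class_A (\<lambda>p. q p + q' p) = class_A q \<oplus>\<^bsub>ring_A\<^esub> class_A q'"
    unfolding class_A_def H.hom_add [OF f f, symmetric] eventually_almost_all_primes
    by (intro coset_sum_Fp_eqI f P.a_closed)
  have "eventually (\<lambda>p. ?f (\<lambda>p. q p * q' p) p = (?f q \<otimes>\<^bsub>prod_Fp\<^esub> ?f q') p) almost_all_primes"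
    using q q' eventually_in_Primes
    by eventually_elim
       (simp add: prod_Fp_def product_ring_def residue_ring_def rat_mod_mult)
  thus "class_A (\<lambda>p. q p * q' p) = class_A q \<otimes>\<^bsub>ring_A\<^esub> class_A q'"
    unfolding class_A_def H.hom_mult [OF f f, symmetric] eventually_almost_all_primes
    by (intro coset_sum_Fp_eqI f P.m_closed)
qed

lemma class_A_sum:
  assumes "finite S"
    and "\<And>i. i \<in> S \<Longrightarrow> eventually (\<lambda>p. p_integral p (q i p)) almost_all_primes"
  shows "class_A (\<lambda>p. \<Sum>i\<in>S. q i p) = (\<Oplus>\<^bsub>ring_A\<^esub> i\<in>S. class_A (q i))"
proof -
  interpret A: cring ring_A by (rule cring_ring_A)
  have zero: "class_A (\<lambda>_. 0) = \<zero>\<^bsub>ring_A\<^esub>"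
  proof -
    \<comment> \<open>An element equal to its own double is zero, by cancellation.\<close>
    have "class_A (\<lambda>_. 0) \<oplus>\<^bsub>ring_A\<^esub> class_A (\<lambda>_. 0) = class_A (\<lambda>_. 0)"
      using rat_A_add[of 0 0] by (simp add: rat_A_def)
    thus ?thesis
      using A.add.r_cancel_one class_A_closed by blast
  qed
  show ?thesis
    using assms
  proof (induction S rule: finite_induct)
    case empty
    show ?case by (simp add: zero)
  next
    case (insert i S)
    have S: "eventually (\<lambda>p. p_integral p (\<Sum>i\<in>S. q i p)) almost_all_primes"
    proof -
      have "eventually (\<lambda>p. \<forall>i\<in>S. p_integral p (q i p)) almost_all_primes"
        using insert by (simp add: eventually_ball_finite)
      thus ?thesis
        using eventually_in_Primes
        by eventually_elim (auto simp: Primes_def intro: p_integral_sum)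
    qed
    show ?case
      using insert S by (simp add: class_A_add class_A_closed Pi_def)
  qed
qed

section \<open>The truncated sums modulo a prime\<close>

lemma D_sum_rec:
  assumes "r \<ge> 1" "N \<ge> 1"
  shows "D_sum r N (n + r) x =
           x * (\<Sum>i\<le>n. of_nat (n choose i) * D_sum r N i x)
           - x * of_nat N ^ n * (x ^ (N - 1) / fact (N - 1) ^ r)"
proof -
  obtain M where N: "N = Suc M" using assms(2) by (cases N) auto
  \<comment> \<open>\<open>x * t k\<close> is the summand of \<open>D_sum r N (n + r) x\<close> at
    index \<open>k + 1\<close>, after \<open>(k + 1) ^ r\<close> is cancelled against the
    factorial.\<close>
  define t where "t k = of_nat (Suc k) ^ n * x ^ k / fact k ^ r" for k
  \<comment> \<open>The summand at index 0 vanishes because \<open>n + r > 0\<close>.\<close>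
  have "D_sum r N (n + r) x = (\<Sum>k<M. of_nat (Suc k) ^ (n + r) * x ^ Suc k / fact (Suc k) ^ r)"
    using assms(1) by (simp only: D_sum_def N sum.lessThan_Suc_shift) simp
  also have "\<dots> = (\<Sum>k<M. x * t k)"
  proof (rule sum.cong)
    fix k
    have "of_nat (Suc k) ^ r \<noteq> (0 :: rat)" by (metis of_nat_0_eq_iff power_not_zero nat.distinct(2))
    thus "of_nat (Suc k) ^ (n + r) * x ^ Suc k / fact (Suc k) ^ r = x * t k"
      by (simp add: t_def power_add power_mult_distrib fact_Suc del: of_nat_Suc)
  qed simp
  \<comment> \<open>The shifted sum is one term short of a full truncated sum; the added term
    \<open>k = N - 1\<close> is the boundary term.\<close>
  also have "\<dots> = x * (\<Sum>k<N. t k) - x * t M"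
    by (simp add: N algebra_simps sum_distrib_left)
  also have "(\<Sum>k<N. t k) = (\<Sum>k<N. \<Sum>i\<le>n. of_nat (n choose i) * (of_nat k ^ i * x ^ k / fact k ^ r))"
  proof (rule sum.cong)
    fix k
    have "(of_nat (Suc k) :: rat) ^ n = (\<Sum>i\<le>n. of_nat (n choose i) * of_nat k ^ i)"
      using binomial_ring[of "of_nat k :: rat" 1 n] by (simp add: add.commute)
    thus "t k = (\<Sum>i\<le>n. of_nat (n choose i) * (of_nat k ^ i * x ^ k / fact k ^ r))"
      by (simp add: t_def sum_distrib_right sum_divide_distrib mult.assoc)
  qed simp
  also have "\<dots> = (\<Sum>i\<le>n. of_nat (n choose i) * D_sum r N i x)"
    by (subst sum.swap) (simp add: D_sum_def sum_distrib_left)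
  finally show ?thesis by (simp add: t_def N mult.assoc)
qed

section \<open>Integrality of the sums and coefficients at \<open>p\<close>\<close>

lemma p_integral_D_sum:
  assumes p: "prime p" and x: "p_integral p x"
  shows "p_integral p (D_sum r p n x)"
proof -
  have "p_integral p (of_nat k ^ n * x ^ k * (1 / fact k) ^ r)" if "k < p" for k
    using p x p_integral_inverse_fact[OF p that] by (intro p_integral_intros)
  thus ?thesis
    unfolding D_sum_def using p by (intro p_integral_sum) (auto simp: power_one_over)
qed

text \<open>The recursion uses only ring operations on integers and \<open>x\<close>, and
  \<open>r \<ge> 1\<close> makes all indices up to \<open>n - r\<close> smaller than
  \<open>n\<close>.\<close>

lemma p_integral_b_coeff:
  assumes "r \<ge> 1" and p: "prime p" and x: "p_integral p x"
  shows "p_integral p (b_coeff r j n x)"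
proof (induction n rule: less_induct)
  case (less n)
  show ?case
    unfolding b_coeff.simps[of r j n x] using less assms
    by (auto intro!: p_integral_intros)
qed

lemma p_integral_g_coeff:
  assumes "r \<ge> 1" and p: "prime p" and x: "p_integral p x"
  shows "p_integral p (g_coeff r n x)"
proof (induction n rule: less_induct)
  case (less n)
  show ?case
    unfolding g_coeff.simps[of r n x] using less assms
    by (auto intro!: p_integral_intros)
qed

text \<open>Fermat for numerator and denominator gives \<open>x ^ (p - 1)\<close> congruent to 1;
  Wilson gives \<open>(-1) ^ r\<close> for the factorial power, and this sign is its own
  inverse.\<close>

lemma p_cong_boundary_term:
  assumes p: "prime p" and a: "\<not> int p dvd a" and d: "\<not> int p dvd d"
    and x: "x = of_int a / of_int d"
  shows "p_cong p (x ^ (p - 1) / fact (p - 1) ^ r) ((-1) ^ r)"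
proof -
  define F :: int where "F = fact (p - 1) ^ r"
  define D where "D = d ^ (p - 1) * F"
  \<comment> \<open>The difference of the two sides is \<open>A / D\<close>, so it suffices that
    \<open>p\<close> divides \<open>A\<close> but not \<open>D\<close>.\<close>
  define A where "A = a ^ (p - 1) - (-1) ^ r * D"
  have fermat: "[c ^ (p - 1) = 1] (mod int p)" if "\<not> int p dvd c" for c
  proof -
    have "coprime c (int p)"
      using that p by (metis coprime_commute prime_imp_coprime prime_nat_int_transfer)
    thus ?thesis
      using residues.euler_theorem[of "int p" c] prime_gt_1_nat[OF p] p
      by (simp add: residues_def totient_prime)
  qed
  have "[F = (-1) ^ r] (mod int p)"
    unfolding F_def using wilson_theorem[OF p] by (intro cong_pow) simp
  hence D1: "[D = 1 * (-1) ^ r] (mod int p)"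
    unfolding D_def by (intro cong_mult fermat d)
  hence "[A = 1 - (-1) ^ r * (1 * (-1) ^ r)] (mod int p)"
    unfolding A_def by (intro cong_diff cong_mult cong_refl fermat a)
  hence "int p dvd A"
    by (simp add: cong_0_iff flip: power_mult_distrib)
  then obtain z where z: "A = int p * z" by blast
  have D: "\<not> int p dvd D"
  proof
    assume "int p dvd D"
    hence "int p dvd (-1) ^ r" using D1 cong_dvd_iff by fastforce
    thus False using prime_gt_1_nat[OF p] by (cases "even r") auto
  qed
  hence "D \<noteq> 0" by auto
  have "x ^ (p - 1) / fact (p - 1) ^ r = of_int (a ^ (p - 1)) / of_int D"
    by (simp add: x D_def F_def power_divide)
  also have "\<dots> = (-1) ^ r + of_int A / of_int D"
    using \<open>D \<noteq> 0\<close> by (simp add: A_def field_simps)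
  also have "of_int A / of_int D = of_nat p * (of_int z / of_int D :: rat)"
    by (simp add: z)
  finally show ?thesis
    unfolding p_cong_def using p_integral_fraction[OF D] by blast
qed

text \<open>Strong induction: for \<open>n < r\<close> the right-hand side collapses to
  \<open>D_sum r p n x\<close>, and from \<open>r\<close> on both sides obey the same recursion with
  congruent inhomogeneous terms.\<close>

lemma p_cong_D_sum:
  assumes r: "r \<ge> 1" and p: "prime p" and a: "\<not> int p dvd a" and d: "\<not> int p dvd d"
    and x: "x = of_int a / of_int d"
  shows "p_cong p (D_sum r p n x) ((\<Sum>j<r. b_coeff r j n x * D_sum r p j x) + g_coeff r n x)"
    (is "p_cong p (?D n) (?E n)")
proof (induction n rule: less_induct)
  case (less n)
  have x_int: "p_integral p x"
    unfolding x by (rule p_integral_fraction[OF d])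
  show ?case
  proof (cases "n < r")
    case True
    have "(\<Sum>j<r. b_coeff r j n x * D_sum r p j x) = (\<Sum>j<r. if j = n then D_sum r p j x else 0)"
      using True by (intro sum.cong) (auto simp: b_coeff_initial)
    thus ?thesis
      using True p by (simp add: g_coeff_initial p_cong_refl)
  next
    case False
    then obtain m where n: "n = m + r" by (metis add.commute le_Suc_ex not_less)
    \<comment> \<open>\<open>g_coeff r r x\<close> is an initial value, whereas the recursion at
      \<open>m = 0\<close> would give \<open>x * g_coeff r 0 x = 0\<close>; \<open>e\<close> is this
      defect.\<close>
    define e where "e = (if m = 0 then x * (-1) ^ (r - 1) else 0)"
    define w where "w = x ^ (p - 1) / fact (p - 1) ^ r"
    have w: "p_cong p w ((-1) ^ r)"
      unfolding w_def by (rule p_cong_boundary_term[OF p a d x])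
    have D: "?D n = x * (\<Sum>i\<le>m. of_nat (m choose i) * ?D i) + (- x * of_nat p ^ m) * w"
      unfolding n w_def using prime_ge_1_nat[OF p] r by (subst D_sum_rec) auto
    have g: "g_coeff r n x = x * (\<Sum>i\<le>m. of_nat (m choose i) * g_coeff r i x) + e"
      using r by (cases "m = 0") (simp_all add: n e_def g_coeff_rec g_coeff_initial)
    have "(\<Sum>j<r. b_coeff r j n x * ?D j)
            = (\<Sum>j<r. \<Sum>i\<le>m. x * of_nat (m choose i) * (b_coeff r j i x * ?D j))"
      unfolding n b_coeff_rec[OF r]
      by (simp add: sum_distrib_left sum_distrib_right mult_ac)
    also have "\<dots> = x * (\<Sum>i\<le>m. of_nat (m choose i) * (\<Sum>j<r. b_coeff r j i x * ?D j))"
      by (subst sum.swap) (simp add: sum_distrib_left mult_ac)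
    finally have E: "?E n = x * (\<Sum>i\<le>m. of_nat (m choose i) * ?E i) + e"
      unfolding g by (simp add: sum.distrib ring_distribs)
    \<comment> \<open>By \<open>D\<close>, \<open>E\<close> and the induction hypothesis, only the
      inhomogeneous terms remain to be compared.\<close>
    have "p_cong p ((- x * of_nat p ^ m) * w) e"
    proof (cases "m = 0")
      case True
      have "p_cong p (- x * w) (- x * (-1) ^ r)"
        using p x_int w by (intro p_cong_mult_left p_integral_minus)
      also have "- x * (-1) ^ r = e"
        using r True by (cases r) (auto simp: e_def)
      finally show ?thesis using True by simp
    next
      case False
      obtain z where z: "p_integral p z" "w = (-1) ^ r + of_nat p * z"
        using w by (auto simp: p_cong_def)
      hence "p_integral p w"
        using p p_integral_of_int[OF p, of "-1"] by (auto intro!: p_integral_intros)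
      \<comment> \<open>For \<open>m > 0\<close> one factor \<open>p\<close> splits off the boundary
        term; this is its integral cofactor.\<close>
      hence "p_integral p (- x * of_nat p ^ (m - 1) * w)"
        using p x_int by (intro p_integral_intros)
      moreover have "(- x * of_nat p ^ m) * w = e + of_nat p * (- x * of_nat p ^ (m - 1) * w)"
        using False by (cases m) (auto simp: e_def)
      ultimately show ?thesis
        unfolding p_cong_def by blast
    qed
    thus ?thesis
      unfolding D E using p x_int r less.IH
      by (intro p_cong_add p_cong_mult_left p_cong_sum p_integral_of_nat) (auto simp: n)
  qed
qed

section \<open>From congruences at almost all primes to the identity in
  \<open>ring_A\<close>\<close>

theorem theorem2p10:
  fixes r n :: nat and x :: rat
  assumes "r \<ge> 1" and "x \<noteq> 0"
  shows "D_A r n x =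
           (\<Oplus>\<^bsub>ring_A\<^esub> j\<in>{0..<r}. rat_A (b_coeff r j n x) \<otimes>\<^bsub>ring_A\<^esub> D_A r j x)
           \<oplus>\<^bsub>ring_A\<^esub> rat_A (g_coeff r n x)"
proof -
  obtain a d where "quotient_of x = (a, d)" by fastforce
  hence x: "x = of_int a / of_int d" and "d > 0"
    using quotient_of_div quotient_of_denom_pos by blast+
  \<comment> \<open>Here \<open>x \<noteq> 0\<close> enters: Fermat's theorem requires primes not
    dividing the numerator, and only finitely many may be excluded.\<close>
  hence "a * d \<noteq> 0" using assms(2) by auto
  hence "eventually (\<lambda>p. \<not> int p dvd a * d) almost_all_primes"
    using finite_prime_divisors_int by (simp add: eventually_almost_all_primes)
  hence good: "eventually (\<lambda>p. prime p \<and> \<not> int p dvd a \<and> \<not> int p dvd d) almost_all_primes"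
    using eventually_in_Primes by eventually_elim (auto simp: Primes_def)
  hence "eventually (\<lambda>p. prime p \<and> p_integral p x) almost_all_primes"
    by eventually_elim (auto simp: x p_integral_fraction)
  hence int: "eventually (\<lambda>p. p_integral p (D_sum r p j x)) almost_all_primes"
    "eventually (\<lambda>p. p_integral p (b_coeff r j n x)) almost_all_primes"
    "eventually (\<lambda>p. p_integral p (b_coeff r j n x * D_sum r p j x)) almost_all_primes"
    "eventually (\<lambda>p. p_integral p (\<Sum>j\<in>{0..<r}. b_coeff r j n x * D_sum r p j x)) almost_all_primes"
    "eventually (\<lambda>p. p_integral p (g_coeff r n x)) almost_all_primes" for j
    using assms(1)
    by (auto elim!: eventually_mono
        intro!: p_integral_D_sum p_integral_b_coeff p_integral_g_coeff p_integral_mult p_integral_sum)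
  have "D_A r n x =
      class_A (\<lambda>p. (\<Sum>j\<in>{0..<r}. b_coeff r j n x * D_sum r p j x) + g_coeff r n x)"
    unfolding D_A_def
  proof (rule class_A_eqI)
    show "eventually (\<lambda>p. rat_mod p (D_sum r p n x) =
      rat_mod p ((\<Sum>j\<in>{0..<r}. b_coeff r j n x * D_sum r p j x) + g_coeff r n x)) almost_all_primes"
      using good int(4,5) eventually_in_Primes
    proof eventually_elim
      case (elim p)
      thus ?case
        using p_cong_D_sum[OF assms(1) _ _ _ x, of p n]
        by (intro rat_mod_eq_if_p_cong p_integral_add) (auto simp: lessThan_atLeast0)
    qed
  qed
  also have "\<dots> = (\<Oplus>\<^bsub>ring_A\<^esub> j\<in>{0..<r}. class_A (\<lambda>p. b_coeff r j n x * D_sum r p j x))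
      \<oplus>\<^bsub>ring_A\<^esub> rat_A (g_coeff r n x)"
    unfolding rat_A_def using int by (simp add: class_A_add class_A_sum)
  also have "(\<lambda>j. class_A (\<lambda>p. b_coeff r j n x * D_sum r p j x)) =
      (\<lambda>j. rat_A (b_coeff r j n x) \<otimes>\<^bsub>ring_A\<^esub> D_A r j x)"
    unfolding rat_A_def D_A_def using int by (simp add: class_A_mult)
  finally show ?thesis .
qed

end
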